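(* Let $A,B\in\mathbb{C}_{n,n}$ with $\mathrm{Ind}(A)=k$, $\mathrm{Ind}(B)=t$, $\mathrm{rk}(A^{k})=\mathrm{rk}\big((A^{k})^{\sim}A^{k}\big)=r$ and $\mathrm{rk}(B^{t})=\mathrm{rk}\big((B^{t})^{\sim}B^{t}\big)=s\ge r$. Let $A=\widehat{A_1}+\widehat{A_2}$ and $B=\widehat{B_1}+\widehat{B_2}$ be the $\mathfrak{m}$-core-EP decompositions of $A$ and $B$, respectively. Then $$A\overset{(\mathrm{E})}{\leq}B\iff \widehat{A_1}\overset{(\mathrm{m})}{\leq}\widehat{B_1}.$$
   Context: $\mathbb{C}_{n,n}$ is the set of $n\times n$ complex matrices; $A^*$, $\mathrm{rk}(A)$, $\mathcal{R}(A)$ denote conjugate transpose, rank and column space. $\mathrm{Ind}(A)$ is the smallest positive integer $k$ with $\mathrm{rk}(A^{k+1})=\mathrm{rk}(A^k)$. The Minkowski metric matrix is $G=\begin{bmatrix}1&0\\ 0&-I_{n-1}\end{bmatrix}$ and the Minkowski adjoint of $A$ is $A^{\sim}=GA^*G$. For $A$ with $\mathrm{Ind}(A)=k$, the $\mathfrak{m}$-core-EP inverse $A^{(\mathrm{E})}$ of $A$ is the matrix $X\in\mathbb{C}_{n,n}$ (unique if it exists) satisfying $XAX=X$, $XA^{k+1}=A^k$, $(AX)^{\sim}=AX$ and $\mathcal{R}(X)\subseteq\mathcal{R}(A^k)$; it exists if and only if $\mathrm{rk}(A^k)=\mathrm{rk}((A^k)^{\sim}A^k)$. The $\mathfrak{m}$-core-EP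 order: for $A,B\in\mathbb{C}_{n,n}$ with $\mathrm{rk}(A^k)=\mathrm{rk}((A^k)^{\sim}A^k)$, $k=\mathrm{Ind}(A)$, write $A\overset{(\mathrm{E})}{\leq}B$ if $A^{(\mathrm{E})}A=A^{(\mathrm{E})}B$ and $AA^{(\mathrm{E})}=BA^{(\mathrm{E})}$. For $C\in\mathbb{C}_{n,n}$ with $\mathrm{rk}(C^2)=\mathrm{rk}(C)$, the $\mathfrak{m}$-core inverse $C^{(\mathrm{m})}$ is the matrix $X$ (unique if it exists) satisfying $CXC=C$, $CX^2=X$, $(CX)^{\sim}=CX$; it exists if and only if $\mathrm{rk}(C^{\sim}C)=\mathrm{rk}(C)$. The $\mathfrak{m}$-core partial order: for such $\mathfrak{m}$-core invertible $C$ and $D$, write $C\overset{(\mathrm{m})}{\leq}D$ if $C^{(\mathrm{m})}C=C^{(\mathrm{m})}D$ and $CC^{(\mathrm{m})}=DC^{(\mathrm{m})}$. The $\mathfrak{m}$-core-EP decomposition of a matrix $A$ with $\mathrm{Ind}(A)=k$ and $\mathrm{rk}(A^k)=\mathrm{rk}((A^k)^{\sim}A^k)$ is the (existing and unique) decomposition $A=\widehat{A_1}+\widehat{A_2}$ with (i) $\mathrm{rk}(\widehat{A_1}^2)=\mathrm{rk}(\widehat{A_1})=\mathrm{rk}(\widehat{A_1}^{\sim}\widehat{A_1})$; (ii) $\widehat{A_2}^k=0$; (iii) $\widehat{A_1}^{\sim}\widehat{A_2}=\widehat{A_2}\widehat{A_1}=0$. *)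

theory Defs
  imports Complex_Main "Jordan_Normal_Form.DL_Rank" "Jordan_Normal_Form.Schur_Decomposition"
begin

text \<open>
  Throughout, \<open>n\<close> is the size of the matrices, which live in \<open>carrier_mat n n\<close>; the dimension is an
  explicit parameter because \<^const>\<open>vec_space.rank\<close> and \<^const>\<open>vec_space.col_space\<close> need it.
\<close>

definition minkowski_mat :: "nat \<Rightarrow> complex mat" where
  "minkowski_mat n =
     four_block_mat (1\<^sub>m 1) (0\<^sub>m 1 (n - 1)) (0\<^sub>m (n - 1) 1) (- (1\<^sub>m (n - 1)))"

definition minkowski_adjoint :: "nat \<Rightarrow> complex mat \<Rightarrow> complex mat" where
  "minkowski_adjoint n A = minkowski_mat n * mat_adjoint A * minkowski_mat n"

text \<open>The index is the least \<^emph>\<open>positive\<close> such exponent, so an invertible matrix has index 1.\<close>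

definition mat_index :: "nat \<Rightarrow> complex mat \<Rightarrow> nat" where
  "mat_index n A =
     (LEAST k. 0 < k \<and> vec_space.rank n (A ^\<^sub>m (k + 1)) = vec_space.rank n (A ^\<^sub>m k))"

definition is_m_core_EP_inverse :: "nat \<Rightarrow> complex mat \<Rightarrow> complex mat \<Rightarrow> bool" where
  "is_m_core_EP_inverse n A X \<longleftrightarrow>
     X \<in> carrier_mat n n \<and>
     X * A * X = X \<and>
     X * A ^\<^sub>m (mat_index n A + 1) = A ^\<^sub>m (mat_index n A) \<and>
     minkowski_adjoint n (A * X) = A * X \<and>
     vec_space.col_space n X \<subseteq> vec_space.col_space n (A ^\<^sub>m (mat_index n A))"

definition m_core_EP_invertible :: "nat \<Rightarrow> complex mat \<Rightarrow> bool" where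
  "m_core_EP_invertible n A \<longleftrightarrow>
     A \<in> carrier_mat n n \<and>
     (let Ak = A ^\<^sub>m (mat_index n A) in
        vec_space.rank n Ak = vec_space.rank n (minkowski_adjoint n Ak * Ak))"

text \<open>
  The inverses below are given by definite descriptions; they are meaningful only for
  matrices with \<open>m_core_EP_invertible\<close> resp. \<open>m_core_invertible\<close>, where the described matrix
  exists and is unique. The orders are therefore relations restricted to these domains.
\<close>

definition m_core_EP_inverse :: "nat \<Rightarrow> complex mat \<Rightarrow> complex mat" where
  "m_core_EP_inverse n A = (THE X. is_m_core_EP_inverse n A X)"

definition m_core_EP_le :: "nat \<Rightarrow> complex mat \<Rightarrow> complex mat \<Rightarrow> bool" where
  "m_core_EP_le n A B \<longleftrightarrow>
     m_core_EP_invertible n A \<and> B \<in> carrier_mat n n \<and>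
     m_core_EP_inverse n A * A = m_core_EP_inverse n A * B \<and>
     A * m_core_EP_inverse n A = B * m_core_EP_inverse n A"

definition is_m_core_inverse :: "nat \<Rightarrow> complex mat \<Rightarrow> complex mat \<Rightarrow> bool" where
  "is_m_core_inverse n C X \<longleftrightarrow>
     X \<in> carrier_mat n n \<and>
     C * X * C = C \<and>
     C * X ^\<^sub>m 2 = X \<and>
     minkowski_adjoint n (C * X) = C * X"

definition m_core_invertible :: "nat \<Rightarrow> complex mat \<Rightarrow> bool" where
  "m_core_invertible n C \<longleftrightarrow>
     C \<in> carrier_mat n n \<and>
     vec_space.rank n (C ^\<^sub>m 2) = vec_space.rank n C \<and>
     vec_space.rank n (minkowski_adjoint n C * C) = vec_space.rank n C"

definition m_core_inverse :: "nat \<Rightarrow> complex mat \<Rightarrow> complex mat" where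
  "m_core_inverse n C = (THE X. is_m_core_inverse n C X)"

definition m_core_le :: "nat \<Rightarrow> complex mat \<Rightarrow> complex mat \<Rightarrow> bool" where
  "m_core_le n C D \<longleftrightarrow>
     m_core_invertible n C \<and> m_core_invertible n D \<and>
     m_core_inverse n C * C = m_core_inverse n C * D \<and>
     C * m_core_inverse n C = D * m_core_inverse n C"

definition is_m_core_EP_decomp :: "nat \<Rightarrow> complex mat \<Rightarrow> complex mat \<Rightarrow> complex mat \<Rightarrow> bool" where
  "is_m_core_EP_decomp n A A1 A2 \<longleftrightarrow>
     A1 \<in> carrier_mat n n \<and> A2 \<in> carrier_mat n n \<and>
     A = A1 + A2 \<and>
     vec_space.rank n (A1 ^\<^sub>m 2) = vec_space.rank n A1 \<and>
     vec_space.rank n A1 = vec_space.rank n (minkowski_adjoint n A1 * A1) \<and>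
     A2 ^\<^sub>m (mat_index n A) = 0\<^sub>m n n \<and>
     minkowski_adjoint n A1 * A2 = 0\<^sub>m n n \<and>
     A2 * A1 = 0\<^sub>m n n"

end

(* Writing A = A1 + A2, the m-core inverse X of A1 satisfies A2 X = X A2 = 0, and therefore it is also
   the m-core-EP inverse of A, so both orders compare the same matrix X with A, B and with A1, B1.
   For the m-core-EP decomposition B = B1 + B2, either order makes X = B X^2 or X = B1 X^2, which
   forces the columns of X into the range of B1; hence B2 X = 0. Then X B2 = 0 as well, because
   X = X (B1 X), the matrix B1 X is self-adjoint, and the adjoint of B1 annihilates B2. *)

theory Submission
  imports Defs "Jordan_Normal_Form.Matrix_Kernel"
begin

section \<open>Rank, column space and factorization through a product\<close>

lemma (in vec_space) lin_indpt_in_span_rank: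
  assumes A: "A \<in> carrier_mat n nc" and T: "T \<subseteq> span (set (cols A))" and li: "lin_indpt T"
  shows "card T \<le> rank A" and "card T = rank A \<Longrightarrow> span T = span (set (cols A))"
proof -
  let ?W = "span (set (cols A))"
  have S: "set (cols A) \<subseteq> carrier_vec n" using A cols_dim[of A] by simp
  have sub: "submodule class_ring ?W V" using S by (rule span_is_submodule)
  \<comment> \<open>The column space becomes a vector space of its own, of dimension
    \<open>rank A\<close>; \<open>span_li_not_depend\<close> carries independence and spans between
    it and the ambient space.\<close>
  interpret W: vectorspace class_ring "vs ?W"
    using span_is_subspace[OF S] by (rule subspace_is_vs)
  have fd: "W.fin_dim" using fin_dim_span_cols[OF A] .
  have liW: "W.lin_indpt T" using span_li_not_depend(2)[OF T sub] li by simp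
  have TW: "T \<subseteq> carrier (vs ?W)" using T by simp
  show "card T \<le> rank A" unfolding rank_def by (rule W.li_le_dim(2)[OF fd TW liW])
  assume eq: "card T = rank A"
  have "W.basis T"
    by (rule W.dim_li_is_basis[OF fd _ TW liW]) (use W.li_le_dim(1)[OF fd TW liW] eq in \<open>auto simp: rank_def\<close>)
  then have "W.span T = carrier (vs ?W)" unfolding W.basis_def by simp
  then show "span T = ?W" using span_li_not_depend(1)[OF T sub] by simp
qed

lemma (in vec_space) rank_eq_card_lin_indpt:
  assumes A: "A \<in> carrier_mat n nc"
  obtains T where "T \<subseteq> set (cols A)" "lin_indpt T" "card T = rank A"
proof -
  have "finite (set (cols A))" "{} \<subseteq> set (cols A)" "lin_indpt {}"
    by (auto simp: lin_dep_def)
  then obtain T where "maximal T (\<lambda>T. T \<subseteq> set (cols A) \<and> lin_indpt T)"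
    using maximal_exists_superset[of "set (cols A)" "\<lambda>T. T \<subseteq> set (cols A) \<and> lin_indpt T" "{}"] by auto
  then show thesis using that rank_card_indpt[OF A] unfolding maximal_def by metis
qed

text \<open>An independent set of \<open>rank B\<close> columns of \<open>B\<close> lies in the
  column space of \<open>A\<close>. Its size bounds the rank, and if that size is
  \<open>rank A\<close>, the set spans the column space of \<open>A\<close>.\<close>

lemma (in vec_space) rank_mono_col_space:
  assumes A: "A \<in> carrier_mat n nc" and B: "B \<in> carrier_mat n nc'"
    and sub: "col_space B \<subseteq> col_space A"
  shows "rank B \<le> rank A" and "rank B = rank A \<Longrightarrow> col_space A \<subseteq> col_space B"
proof -
  obtain T where T: "T \<subseteq> set (cols B)" "lin_indpt T" "card T = rank B"
    using rank_eq_card_lin_indpt[OF B] .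
  have SB: "set (cols B) \<subseteq> carrier_vec n" using B cols_dim[of B] by simp
  have TA: "T \<subseteq> span (set (cols A))"
    using T(1) in_own_span[OF SB] sub unfolding col_space_def by blast
  show "rank B \<le> rank A" using lin_indpt_in_span_rank(1)[OF A TA T(2)] T(3) by simp
  assume "rank B = rank A"
  then have "span T = col_space A"
    using lin_indpt_in_span_rank(2)[OF A TA T(2)] T(3) unfolding col_space_def by simp
  moreover have "span T \<subseteq> col_space B" unfolding col_space_def by (rule span_is_monotone[OF T(1)])
  ultimately show "col_space A \<subseteq> col_space B" by simp
qed

lemma (in vec_space) mult_mat_vec_in_col_space:
  assumes "A \<in> carrier_mat n nc" "v \<in> carrier_vec nc"
  shows "A *\<^sub>v v \<in> col_space A"
  using assms col_space_eq[OF assms(1)] by auto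

lemma (in vec_space) col_space_mult_subset:
  assumes A: "A \<in> carrier_mat n nc" and B: "B \<in> carrier_mat nc m"
  shows "col_space (A * B) \<subseteq> col_space A"
proof
  have AB: "A * B \<in> carrier_mat n m" using A B by simp
  fix y assume "y \<in> col_space (A * B)"
  then obtain v where v: "v \<in> carrier_vec m" "y = A * B *\<^sub>v v"
    using col_space_eq[OF AB] A B by auto
  then show "y \<in> col_space A"
    using mult_mat_vec_in_col_space[OF A, of "B *\<^sub>v v"] A B by (simp add: assoc_mult_mat_vec[OF A B])
qed

text \<open>Each column of \<open>B\<close> is \<open>A\<close> applied to some vector; these
  vectors form the columns of the factor.\<close>

lemma (in vec_space) col_space_subset_imp_factor:
  assumes A: "A \<in> carrier_mat n nc" and B: "B \<in> carrier_mat n m"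
    and sub: "col_space B \<subseteq> col_space A"
  obtains Z where "Z \<in> carrier_mat nc m" "B = A * Z"
proof -
  have "\<exists>z \<in> carrier_vec nc. A *\<^sub>v z = col B j" if j: "j < m" for j
  proof -
    have "col B j = B *\<^sub>v unit_vec m j" using B j by (intro eq_vecI) auto
    then have "col B j \<in> col_space A" using sub mult_mat_vec_in_col_space[OF B, of "unit_vec m j"] by auto
    then show ?thesis using col_space_eq[OF A] A by auto
  qed
  then obtain z where z: "\<And>j. j < m \<Longrightarrow> z j \<in> carrier_vec nc \<and> A *\<^sub>v z j = col B j" by metis
  define Z where "Z = mat_of_cols nc (map z [0..<m])"
  have Z: "Z \<in> carrier_mat nc m" unfolding Z_def by auto
  have "B = A * Z"
  proof (rule mat_col_eqI)
    fix j assume j: "j < dim_col (A * Z)"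
    then have j: "j < m" using Z by simp
    then have "col Z j = z j" unfolding Z_def using z[OF j] by simp
    then show "col B j = col (A * Z) j" using z[OF j] col_mult2[OF A Z j] by simp
  qed (use A B Z in auto)
  with Z show thesis using that by blast
qed

lemma (in vec_space) rank_mult_le:
  assumes A: "A \<in> carrier_mat n nc" and B: "B \<in> carrier_mat nc m"
  shows "rank (A * B) \<le> rank A"
  by (rule rank_mono_col_space(1)[OF A _ col_space_mult_subset[OF A B]]) (use A B in auto)

text \<open>This turns the rank conditions of m-core invertibility into matrix equations: with equal
  ranks, the inclusion between the column spaces of \<open>A * B\<close> and \<open>A\<close> is an
  equality.\<close>

lemma (in vec_space) rank_mult_eq_imp_factor:
  assumes A: "A \<in> carrier_mat n nc" and B: "B \<in> carrier_mat nc m"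
    and eq: "rank (A * B) = rank A"
  obtains Z where "Z \<in> carrier_mat m nc" "A = A * B * Z"
proof -
  have AB: "A * B \<in> carrier_mat n m" using A B by simp
  show thesis
    using col_space_subset_imp_factor[OF AB A rank_mono_col_space(2)[OF A AB col_space_mult_subset[OF A B] eq]]
      that by metis
qed

text \<open>Lets ranks be compared through kernels, which is how \<open>mat_adjoint A * A\<close> is
  compared with \<open>A\<close>.\<close>

lemma (in vec_space) rank_nullity_mat:
  assumes A: "A \<in> carrier_mat n n"
  shows "rank A + vectorspace.dim class_ring (vs (mat_kernel A)) = n"
proof -
  interpret L: linear_map class_ring V V "\<lambda>v. A *\<^sub>v v"
  proof unfold_locales
    show "(\<lambda>v. A *\<^sub>v v) \<in> LinearCombinations.module_hom class_ring V V"
      unfolding LinearCombinations.module_hom_def using A by (auto simp: mult_add_distrib_mat_vec[OF A])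
  qed
  have im: "L.imT = col_space A" unfolding L.im_def using A by (auto simp: col_space_eq[OF A])
  have ker: "L.kerT = mat_kernel A"
    unfolding L.ker_def using A by (auto simp: mat_kernel[OF A])
  show ?thesis using L.rank_nullity[OF fin_dim] unfolding im ker dim_is_n
    by (simp add: rank_def col_space_def)
qed

lemma (in vec_space) rank_eq_if_mat_kernel_eq:
  assumes "A \<in> carrier_mat n n" "B \<in> carrier_mat n n" "mat_kernel A = mat_kernel B"
  shows "rank A = rank B"
  using rank_nullity_mat[OF assms(1)] rank_nullity_mat[OF assms(2)] assms(3) by simp

section \<open>The conjugate transpose\<close>

lemma mat_adjoint_carrier [simp]:
  "A \<in> carrier_mat nr nc \<Longrightarrow> mat_adjoint A \<in> carrier_mat nc nr"
  by (simp add: mat_adjoint_def mat_of_rows_def)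

lemma mat_adjoint_index [simp]:
  "i < dim_col A \<Longrightarrow> j < dim_row A \<Longrightarrow> mat_adjoint A $$ (i, j) = conjugate (A $$ (j, i))"
  by (simp add: mat_adjoint_def mat_of_rows_def)

lemma mat_adjoint_dim [simp]:
  "dim_row (mat_adjoint A) = dim_col A" "dim_col (mat_adjoint A) = dim_row A"
  by (simp_all add: mat_adjoint_def)

lemma mat_adjoint_adjoint [simp]: "mat_adjoint (mat_adjoint A) = A"
  by (rule eq_matI) simp_all

lemma mat_adjoint_mult:
  assumes "A \<in> carrier_mat nr m" "B \<in> carrier_mat m nc"
  shows "mat_adjoint (A * B) = mat_adjoint B * mat_adjoint A"
proof (rule eq_matI)
  fix i j assume "i < dim_row (mat_adjoint B * mat_adjoint A)" "j < dim_col (mat_adjoint B * mat_adjoint A)"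
  then show "mat_adjoint (A * B) $$ (i, j) = (mat_adjoint B * mat_adjoint A) $$ (i, j)"
    using assms by (simp add: scalar_prod_def sum_conjugate conjugate_dist_mul mult.commute)
qed (use assms in auto)

text \<open>If \<open>v\<close> is killed by the product, then \<open>w = A v\<close> has square
  norm equal to the inner product of \<open>mat_adjoint A *\<^sub>v w = 0\<close> with
  \<open>v\<close>, and the standard inner product is definite. The Minkowski form is indefinite for
  n \<ge> 2, so there the analogous rank equality has to be assumed.\<close>

lemma mat_kernel_adjoint_mult:
  fixes A :: "complex mat"
  assumes A: "A \<in> carrier_mat nr nc"
  shows "mat_kernel (mat_adjoint A * A) = mat_kernel A"
proof
  have A': "mat_adjoint A \<in> carrier_mat nc nr" using A by simp
  then have AA: "mat_adjoint A * A \<in> carrier_mat nc nc" using A by (rule mult_carrier_mat)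
  show "mat_kernel A \<subseteq> mat_kernel (mat_adjoint A * A)"
    by (rule mat_kernel_mult_subset[OF A A'])
  show "mat_kernel (mat_adjoint A * A) \<subseteq> mat_kernel A"
  proof
    fix v assume "v \<in> mat_kernel (mat_adjoint A * A)"
    then have v: "v \<in> carrier_vec nc" and z: "mat_adjoint A *\<^sub>v (A *\<^sub>v v) = 0\<^sub>v nc"
      using mat_kernelD[OF AA] assoc_mult_mat_vec[OF A' A] by auto
    define w where "w = A *\<^sub>v v"
    have w: "w \<in> carrier_vec nr" unfolding w_def using A v by simp
    have "w \<bullet>c w = (\<Sum>i<nr. w $ i * conjugate (w $ i))"
      using w by (simp add: scalar_prod_def lessThan_atLeast0)
    also have "\<dots> = (\<Sum>i<nr. \<Sum>j<nc. w $ i * conjugate (A $$ (i, j)) * conjugate (v $ j))"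
      using A v by (intro sum.cong refl)
        (simp add: w_def scalar_prod_def lessThan_atLeast0 sum_conjugate conjugate_dist_mul sum_distrib_left mult.assoc)
    also have "\<dots> = (\<Sum>j<nc. \<Sum>i<nr. w $ i * conjugate (A $$ (i, j)) * conjugate (v $ j))"
      by (rule sum.swap)
    also have "\<dots> = (\<Sum>j<nc. (mat_adjoint A *\<^sub>v w) $ j * conjugate (v $ j))"
      using A w by (intro sum.cong refl)
        (simp add: scalar_prod_def lessThan_atLeast0 sum_distrib_left sum_distrib_right mult_ac)
    also have "\<dots> = 0" using z by (simp add: w_def)
    finally have "w = 0\<^sub>v nr" using w by (simp add: conjugate_square_eq_0_vec)
    then show "v \<in> mat_kernel A" using mat_kernelI[OF A v] by (simp add: w_def)
  qed
qed

text \<open>The rank of \<open>mat_adjoint B * B\<close> is that of \<open>B\<close> and at most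
  that of \<open>mat_adjoint B\<close>. Taking \<open>A\<close> and its adjoint for \<open>B\<close>
  gives both inequalities.\<close>

lemma rank_mat_adjoint:
  fixes A :: "complex mat"
  assumes A: "A \<in> carrier_mat n n"
  shows "vec_space.rank n (mat_adjoint A) = vec_space.rank n A"
proof -
  interpret vec_space "TYPE(complex)" n .
  have le: "rank B \<le> rank (mat_adjoint B)" if B: "B \<in> carrier_mat n n" for B :: "complex mat"
  proof -
    have "rank (mat_adjoint B * B) = rank B"
      using B mat_kernel_adjoint_mult[OF B] by (intro rank_eq_if_mat_kernel_eq) auto
    then show ?thesis using rank_mult_le[of "mat_adjoint B" n B n] B by simp
  qed
  show ?thesis using le[OF A] le[of "mat_adjoint A"] A by simp
qed

section \<open>The Minkowski metric and its adjoint\<close>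

lemma minkowski_mat_carrier: "n \<ge> 1 \<Longrightarrow> minkowski_mat n \<in> carrier_mat n n"
  by (auto simp: minkowski_mat_def)

lemma minkowski_mat_square:
  assumes "n \<ge> 1"
  shows "minkowski_mat n * minkowski_mat n = 1\<^sub>m n"
proof -
  obtain m where n: "n = Suc m" using assms by (cases n) auto
  show ?thesis
    unfolding minkowski_mat_def n
    by (subst mult_four_block_mat[where ?nr1.0=1 and ?nr2.0=m and ?n1.0=1 and ?n2.0=m and ?nc1.0=1 and ?nc2.0=m])
       (auto intro!: eq_matI)
qed

lemma mat_adjoint_minkowski_mat: "mat_adjoint (minkowski_mat n) = minkowski_mat n"
  by (rule eq_matI) (auto simp: minkowski_mat_def)

text \<open>Size 0 is excluded because \<open>minkowski_mat 0\<close> is a 1 by 1 matrix, its upper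
  left block being fixed.\<close>

locale minkowski =
  fixes n :: nat
  assumes n_ge_1: "n \<ge> 1"
begin

sublocale vec_space "TYPE(complex)" n .

abbreviation "M \<equiv> carrier_mat n n :: complex mat set"

abbreviation madj :: "complex mat \<Rightarrow> complex mat"  (\<open>_\<^sup>\<sim>\<close> [1000] 999)
  where "A\<^sup>\<sim> \<equiv> minkowski_adjoint n A"

lemma mult_closed [simp]: "A \<in> M \<Longrightarrow> B \<in> M \<Longrightarrow> A * B \<in> M"
  by (rule mult_carrier_mat)

lemma pow_closed [simp]: "A \<in> M \<Longrightarrow> A ^\<^sub>m k \<in> M"
  by (rule pow_carrier_mat)

lemma massoc: "A \<in> M \<Longrightarrow> B \<in> M \<Longrightarrow> C \<in> M \<Longrightarrow> A * B * C = A * (B * C)"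
  by (rule assoc_mult_mat)

lemma madj_closed [simp]: "A \<in> M \<Longrightarrow> A\<^sup>\<sim> \<in> M"
  by (simp add: minkowski_adjoint_def minkowski_mat_carrier[OF n_ge_1])

lemma minkowski_mat_cancel:
  assumes "A \<in> M"
  shows "minkowski_mat n * (minkowski_mat n * A) = A"
  using assms minkowski_mat_carrier[OF n_ge_1] minkowski_mat_square[OF n_ge_1]
  by (simp flip: massoc del: assoc_mult_mat)

text \<open>The two adjacent metric factors in the middle of the right-hand side cancel.\<close>

lemma madj_mult: "A \<in> M \<Longrightarrow> B \<in> M \<Longrightarrow> (A * B)\<^sup>\<sim> = B\<^sup>\<sim> * A\<^sup>\<sim>"
  by (simp add: minkowski_adjoint_def mat_adjoint_mult[of _ n n _ n] massoc
      minkowski_mat_carrier[OF n_ge_1] minkowski_mat_cancel)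

lemma madj_madj [simp]:
  assumes "A \<in> M"
  shows "(A\<^sup>\<sim>)\<^sup>\<sim> = A"
  using assms minkowski_mat_square[OF n_ge_1]
  by (simp add: minkowski_adjoint_def mat_adjoint_mult[of _ n n _ n] massoc mat_adjoint_minkowski_mat
      minkowski_mat_carrier[OF n_ge_1] minkowski_mat_cancel)

lemma rank_mult_right_inverse:
  assumes "A \<in> M" "U \<in> M" "U' \<in> M" "U * U' = 1\<^sub>m n"
  shows "rank (A * U) = rank A"
  using rank_mult_le[of A n U n] rank_mult_le[of "A * U" n U' n] assms by (simp add: massoc)

text \<open>The conjugate transpose preserves rank, and so does multiplication by the invertible
  metric.\<close>

lemma rank_madj:
  assumes A: "A \<in> M"
  shows "rank (A\<^sup>\<sim>) = rank A"
proof -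
  let ?G = "minkowski_mat n"
  have G: "?G \<in> M" by (rule minkowski_mat_carrier[OF n_ge_1])
  have A': "mat_adjoint A \<in> M" using A by simp
  have "A\<^sup>\<sim> = mat_adjoint (A * ?G) * ?G"
    using A G by (simp add: minkowski_adjoint_def mat_adjoint_mult[of _ n n _ n] mat_adjoint_minkowski_mat)
  then have "rank (A\<^sup>\<sim>) = rank (mat_adjoint (A * ?G))"
    using A G rank_mult_right_inverse[OF _ G G minkowski_mat_square[OF n_ge_1]] by simp
  also have "\<dots> = rank A"
    using A G rank_mat_adjoint[of "A * ?G" n] rank_mult_right_inverse[OF A G G minkowski_mat_square[OF n_ge_1]]
    by simp
  finally show ?thesis .
qed

section \<open>Powers, and existence and uniqueness of the m-core inverse\<close>

lemma pow2: "A \<in> M \<Longrightarrow> A ^\<^sub>m 2 = A * A"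
  by (simp add: numeral_2_eq_2)

lemma pow_Suc_left: "A \<in> M \<Longrightarrow> A ^\<^sub>m Suc k = A * A ^\<^sub>m k"
  by (induction k) (auto simp: massoc)

text \<open>The rank conditions only yield factors on the right. The left factors \<open>W\<close>
  and \<open>Y\<close> arise by factoring \<open>C\<^sup>\<sim>\<close> on the right and taking
  adjoints.\<close>

lemma m_core_invertible_factors:
  assumes "m_core_invertible n C"
  obtains W Y Z where "W \<in> M" "Y \<in> M" "Z \<in> M"
    and "C = W * (C * C)" and "C = Y * (C\<^sup>\<sim> * C)" and "C = C * C * Z"
proof -
  have C: "C \<in> M" and r2: "rank (C * C) = rank C" and rm: "rank (C\<^sup>\<sim> * C) = rank C"
    using assms by (auto simp: m_core_invertible_def pow2)
  obtain Z where Z: "Z \<in> M" "C = C * C * Z"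
    using rank_mult_eq_imp_factor[OF C C r2] .
  obtain Y where Y: "Y \<in> M" "C\<^sup>\<sim> = C\<^sup>\<sim> * C * Y"
    using rank_mult_eq_imp_factor[OF madj_closed[OF C] C] rm rank_madj[OF C] by metis
  have "rank (C\<^sup>\<sim> * C\<^sup>\<sim>) = rank (C\<^sup>\<sim>)"
    using C r2 rank_madj[of "C * C"] rank_madj[of C] by (simp add: madj_mult)
  then obtain W where W: "W \<in> M" "C\<^sup>\<sim> = C\<^sup>\<sim> * C\<^sup>\<sim> * W"
    using rank_mult_eq_imp_factor[OF madj_closed[OF C] madj_closed[OF C]] by metis
  have "C = Y\<^sup>\<sim> * (C\<^sup>\<sim> * C)"
    using arg_cong[OF Y(2), of "minkowski_adjoint n"] C Y(1) by (simp add: madj_mult)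
  moreover have "C = W\<^sup>\<sim> * (C * C)"
    using arg_cong[OF W(2), of "minkowski_adjoint n"] C W(1) by (simp add: madj_mult)
  ultimately show thesis using that W(1) Y(1) Z by (metis madj_closed)
qed

text \<open>With \<open>C = Y C\<^sup>\<sim> C\<close> and \<open>C = C\<^sup>2 Z\<close>, the matrix \<open>P = C Y\<^sup>\<sim>\<close> is the self-adjoint projection onto
  the range of \<open>C\<close>, and \<open>X = C Z Y\<^sup>\<sim>\<close> solves \<open>C X = P\<close> within that range.\<close>

lemma m_core_inverse_exists:
  assumes "m_core_invertible n C"
  shows "\<exists>X. is_m_core_inverse n C X"
proof -
  have C: "C \<in> M" using assms by (simp add: m_core_invertible_def)
  obtain Y Z where Y: "Y \<in> M" "C = Y * (C\<^sup>\<sim> * C)" and Z: "Z \<in> M" "C = C * C * Z"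
    using m_core_invertible_factors[OF assms] by metis
  define P X where "P = C * Y\<^sup>\<sim>" and "X = C * Z * Y\<^sup>\<sim>"
  have M: "P \<in> M" "X \<in> M" "C \<in> M" "Y \<in> M" "Z \<in> M" using C Y Z by (auto simp: P_def X_def)
  have PC: "P\<^sup>\<sim> * C = C" using M Y(2) by (simp add: P_def madj_mult massoc)
  have PP: "P\<^sup>\<sim> * P = P" using M PC by (simp add: P_def flip: massoc del: assoc_mult_mat)
  \<comment> \<open>A matrix of the form \<open>P\<^sup>\<sim> * P\<close> is self-adjoint, hence so
    is \<open>P\<close>.\<close>
  have "P\<^sup>\<sim> = (P\<^sup>\<sim> * P)\<^sup>\<sim>" by (simp only: PP)
  also have "\<dots> = P\<^sup>\<sim> * P" using M by (simp add: madj_mult)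
  also note PP
  finally have sa: "P\<^sup>\<sim> = P" .
  have CX: "C * X = P"
  proof -
    have "C * X = C * C * Z * Y\<^sup>\<sim>" using M by (simp add: X_def massoc)
    then show ?thesis using Z(2) P_def by simp
  qed
  \<comment> \<open>\<open>X\<close> begins with the factor \<open>C\<close>, which \<open>P\<close>
    fixes.\<close>
  have "P * X = P\<^sup>\<sim> * C * (Z * Y\<^sup>\<sim>)" using M sa by (simp add: X_def massoc)
  also have "\<dots> = X" unfolding PC using M by (simp add: X_def massoc)
  finally have PX: "P * X = X" .
  have "C * (X * X) = C * X * X" using M by (simp add: massoc)
  then have "C * X ^\<^sub>m 2 = X" unfolding CX PX pow2[OF M(2)] .
  moreover have "C * X * C = C" using PC unfolding CX sa .
  moreover have "(C * X)\<^sup>\<sim> = C * X" unfolding CX by (rule sa)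
  ultimately show ?thesis unfolding is_m_core_inverse_def using M(2) by blast
qed

lemma is_m_core_inverse_simps:
  assumes "is_m_core_inverse n C X" "C \<in> M"
  shows "X \<in> M" "C * (X * C) = C" "C * (X * X) = X" "(C * X)\<^sup>\<sim> = C * X"
  using assms by (auto simp: is_m_core_inverse_def pow2 massoc)

text \<open>\<open>C * X\<close> and \<open>C * X'\<close> are self-adjoint projections that absorb
  each other, so they are equal; and \<open>X\<close> can be recovered from
  \<open>C * X\<close>.\<close>

lemma is_m_core_inverse_unique:
  assumes inv: "m_core_invertible n C" and X: "is_m_core_inverse n C X" and X': "is_m_core_inverse n C X'"
  shows "X = X'"
proof -
  have C: "C \<in> M" using inv by (simp add: m_core_invertible_def)
  note X = is_m_core_inverse_simps[OF X C] and X' = is_m_core_inverse_simps[OF X' C]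
  have absorb: "C * U * (C * U') = C * U'"
    if "U \<in> M" "U' \<in> M" "C * (U * C) = C" for U U'
  proof -
    have "C * U * (C * U') = C * (U * C) * U'" using that(1,2) C by (simp add: massoc)
    then show ?thesis unfolding that(3) .
  qed
  have "C * X' = (C * X * (C * X'))\<^sup>\<sim>"
    using absorb[of X X'] C X X' by simp
  also have "\<dots> = C * X' * (C * X)"
    using C X X' by (simp add: madj_mult)
  also have "\<dots> = C * X" using absorb[of X' X] X X' by simp
  finally have eq: "C * X = C * X'" by simp
  obtain W where W: "W \<in> M" "C = W * (C * C)" using m_core_invertible_factors[OF inv] by metis
  \<comment> \<open>On the range of \<open>C\<close>, which contains the columns of
    \<open>U\<close>, the matrix \<open>W\<close> undoes multiplication by \<open>C\<close>.\<close>
  have rep: "U = W * (C * U)" if "U \<in> M" "C * (U * U) = U" for U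
  proof -
    have "U = W * (C * C) * (U * U)" using that(2) W(2) by simp
    also have "\<dots> = W * (C * (C * (U * U)))" using that(1) C W(1) by (simp add: massoc)
    finally show ?thesis using that(2) by simp
  qed
  show ?thesis using rep[OF X(1,3)] rep[OF X'(1,3)] eq by simp
qed

lemma m_core_inverse_spec:
  assumes "m_core_invertible n C"
  shows "is_m_core_inverse n C (m_core_inverse n C)"
proof -
  have "\<exists>!X. is_m_core_inverse n C X"
    using m_core_inverse_exists[OF assms] is_m_core_inverse_unique[OF assms] by blast
  then show ?thesis unfolding m_core_inverse_def by (rule theI')
qed

text \<open>Since \<open>W\<close> undoes \<open>C\<close> on its range, it suffices to compare both
  sides after multiplication by \<open>C\<close>, where \<open>C * X * C = C\<close>
  applies.\<close>

lemma m_core_inverse_mult_square: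
  assumes inv: "m_core_invertible n C" and X: "is_m_core_inverse n C X"
  shows "X * (C * C) = C"
proof -
  have C: "C \<in> M" using inv by (simp add: m_core_invertible_def)
  note X = is_m_core_inverse_simps[OF X C]
  obtain W where W: "W \<in> M" "C = W * (C * C)" using m_core_invertible_factors[OF inv] by metis
  have CXX: "C * (X * (X * B)) = X * B" if "B \<in> M" for B
    using that C X(1) arg_cong[OF X(3), of "\<lambda>D. D * B"] by (simp add: massoc)
  have "X * (C * C) = W * (C * C) * (X * (X * (C * C)))"
    using CXX[of "C * C"] C W(2) by simp
  also have "\<dots> = W * (C * (C * (X * (X * (C * C)))))"
    using C W(1) X(1) by (simp add: massoc)
  also have "\<dots> = W * (C * (X * (C * C)))" using CXX[of "C * C"] C by simp
  also have "C * (X * (C * C)) = C * (X * C) * C" using C X(1) by (simp add: massoc)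
  also have "\<dots> = C * C" using X(2) by simp
  finally show ?thesis using W(2) by simp
qed

section \<open>Uniqueness of the m-core-EP inverse\<close>

lemma is_m_core_EP_inverse_unique:
  assumes A: "A \<in> M" and X: "is_m_core_EP_inverse n A X" and X': "is_m_core_EP_inverse n A X'"
  shows "X = X'"
proof -
  let ?k = "mat_index n A"
  have fact: "\<exists>W \<in> M. U = A ^\<^sub>m ?k * W" if "is_m_core_EP_inverse n A U" for U
    using that A col_space_subset_imp_factor[of "A ^\<^sub>m ?k" n U n]
    unfolding is_m_core_EP_inverse_def by (metis pow_closed)
  \<comment> \<open>The range condition makes \<open>U'\<close> a right multiple of the k-th power
    of \<open>A\<close>, which \<open>U * A\<close> fixes.\<close>
  have absorb: "U * (A * U') = U'"
    if U: "is_m_core_EP_inverse n A U" and U': "is_m_core_EP_inverse n A U'" for U U'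
  proof -
    have UM: "U \<in> M" using U by (simp add: is_m_core_EP_inverse_def)
    obtain W where W: "W \<in> M" "U' = A ^\<^sub>m ?k * W" using fact[OF U'] by blast
    have "U * (A * U') = U * A ^\<^sub>m (?k + 1) * W"
      using A UM W pow_Suc_left[OF A, of ?k] by (simp add: massoc del: pow_mat.simps)
    then show ?thesis using U W(2) by (simp add: is_m_core_EP_inverse_def)
  qed
  have XM: "X \<in> M" "(A * X)\<^sup>\<sim> = A * X" and XM': "X' \<in> M" "(A * X')\<^sup>\<sim> = A * X'"
    using X X' by (auto simp: is_m_core_EP_inverse_def)
  \<comment> \<open>Again two self-adjoint projections absorb each other and hence agree.\<close>
  have "A * X' = (A * X * (A * X'))\<^sup>\<sim>"
    using absorb[OF X X'] A XM XM' by (simp add: massoc)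
  also have "\<dots> = A * X' * (A * X)" using A XM XM' by (simp add: madj_mult)
  also have "\<dots> = A * X" using absorb[OF X' X] A XM XM' by (simp add: massoc)
  finally show ?thesis using absorb[OF X X] absorb[OF X X'] by simp
qed

section \<open>Decompositions and their nilpotent parts\<close>

lemma pow_add_if_mult_eq_0:
  assumes "A1 \<in> M" "A2 \<in> M" "A2 * A1 = 0\<^sub>m n n"
  shows "\<exists>S \<in> M. (A1 + A2) ^\<^sub>m j = A1 * S + A2 ^\<^sub>m j"
proof (induction j)
  case 0
  show ?case using assms by (intro bexI[of _ "0\<^sub>m n n"]) auto
next
  case (Suc j)
  then obtain S where S: "S \<in> M" "(A1 + A2) ^\<^sub>m j = A1 * S + A2 ^\<^sub>m j" by blast
  \<comment> \<open>Thus in the expansion of the power, every surviving word other than the pure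
    power of \<open>A2\<close> starts with \<open>A1\<close>.\<close>
  have z: "A2 * (A1 * S) = 0\<^sub>m n n" using assms S by (simp flip: massoc del: assoc_mult_mat)
  have "(A1 + A2) ^\<^sub>m Suc j = (A1 + A2) * (A1 * S + A2 ^\<^sub>m j)"
    using assms S by (simp add: pow_Suc_left del: pow_mat.simps)
  also have "\<dots> = A1 * (A1 * S + A2 ^\<^sub>m j) + A2 * (A1 * S + A2 ^\<^sub>m j)"
    using assms S by (intro add_mult_distrib_mat[of _ n n]) auto
  also have "A2 * (A1 * S + A2 ^\<^sub>m j) = A2 ^\<^sub>m Suc j"
    using assms S z by (simp add: mult_add_distrib_mat[of _ n n _ n] pow_Suc_left del: pow_mat.simps)
  finally show ?case using assms S by (intro bexI[of _ "A1 * S + A2 ^\<^sub>m j"]) auto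
qed

text \<open>Substituting \<open>X = A * X * X\<close> into itself moves one more factor
  \<open>A\<close> to the front each time.\<close>

lemma outer_factor_pow:
  assumes "A \<in> M" "X \<in> M" "A * (X * X) = X"
  shows "\<exists>W \<in> M. X = A ^\<^sub>m j * W"
proof (induction j)
  case 0
  show ?case using assms by auto
next
  case (Suc j)
  then obtain W where W: "W \<in> M" "X = A ^\<^sub>m j * W" by blast
  have "X = A * (A ^\<^sub>m j * W * X)" using assms(3) W(2) by simp
  also have "\<dots> = A ^\<^sub>m Suc j * (W * X)"
    using assms W(1) by (simp add: pow_Suc_left massoc del: pow_mat.simps)
  finally show ?case using assms W(1) by (intro bexI[of _ "W * X"]) auto
qed

lemma is_m_core_EP_decompD:
  assumes "is_m_core_EP_decomp n A A1 A2"
  shows "A1 \<in> M" "A2 \<in> M" "A = A1 + A2" "m_core_invertible n A1"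
    "A2 ^\<^sub>m mat_index n A = 0\<^sub>m n n" "A1\<^sup>\<sim> * A2 = 0\<^sub>m n n" "A2 * A1 = 0\<^sub>m n n"
  using assms unfolding is_m_core_EP_decomp_def m_core_invertible_def by auto

lemma m_core_EP_decomp_pow:
  assumes "is_m_core_EP_decomp n A A1 A2"
  shows "\<exists>S \<in> M. A ^\<^sub>m mat_index n A = A1 * S"
proof -
  note d = is_m_core_EP_decompD[OF assms]
  obtain S where "S \<in> M" "A ^\<^sub>m mat_index n A = A1 * S + 0\<^sub>m n n"
    using pow_add_if_mult_eq_0[OF d(1,2,7), of "mat_index n A"] d(3,5) by metis
  then show ?thesis using d(1) by (intro bexI[of _ S]) auto
qed

text \<open>\<open>X\<close> factors through the index power of \<open>A\<close>, hence through
  \<open>A1\<close>, which \<open>A2\<close> kills. \<open>X\<close> need not be an inverse of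
  \<open>A\<close>, so the fact also applies to \<open>B\<close> with the inverse belonging to
  \<open>A\<close>.\<close>

lemma nilpotent_part_annihilates:
  assumes d: "is_m_core_EP_decomp n A A1 A2"
    and M: "X \<in> M" and eq: "A * (X * X) = X"
  shows "A2 * X = 0\<^sub>m n n"
proof -
  note d' = is_m_core_EP_decompD[OF d]
  obtain S where S: "S \<in> M" "A ^\<^sub>m mat_index n A = A1 * S" using m_core_EP_decomp_pow[OF d] by blast
  obtain W where W: "W \<in> M" "X = A ^\<^sub>m mat_index n A * W"
    using outer_factor_pow[OF _ M eq, of "mat_index n A"] d'(1-3) by auto
  have "A2 * X = A2 * A1 * (S * W)" using d'(1,2) S W by (simp add: massoc)
  then show ?thesis using d'(7) S W by simp
qed

text \<open>Assuming only these two equations on \<open>X\<close> covers both uses: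
  \<open>A1\<close> with its own m-core inverse, and \<open>B1\<close> with that of
  \<open>A1\<close>.\<close>

lemma mult_nilpotent_part:
  assumes d: "is_m_core_EP_decomp n B B1 B2"
    and M: "X \<in> M" and sa: "(B1 * X)\<^sup>\<sim> = B1 * X" and XP: "X * (B1 * X) = X"
  shows "X * B2 = 0\<^sub>m n n"
proof -
  note d' = is_m_core_EP_decompD[OF d]
  have "X * B2 = X * ((B1 * X)\<^sup>\<sim> * B2)"
    using d'(1,2) M XP by (simp add: sa flip: massoc del: assoc_mult_mat)
  also have "(B1 * X)\<^sup>\<sim> * B2 = X\<^sup>\<sim> * (B1\<^sup>\<sim> * B2)"
    using d'(1,2) M by (simp add: madj_mult massoc)
  finally show ?thesis using d'(6) M by (simp add: right_mult_zero_mat[of _ n n])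
qed

lemma m_core_inverse_of_decomp:
  assumes d: "is_m_core_EP_decomp n A A1 A2" and X: "is_m_core_inverse n A1 X"
  shows "X * (A1 * X) = X" "X * A2 = 0\<^sub>m n n" "A2 * X = 0\<^sub>m n n" "A * X = A1 * X" "X * A = X * A1"
proof -
  note d' = is_m_core_EP_decompD[OF d]
  note X' = is_m_core_inverse_simps[OF X d'(1)]
  \<comment> \<open>Expanding the inner \<open>X\<close> as \<open>A1 * (X * X)\<close> creates the
    product \<open>X * (A1 * A1)\<close>, which is \<open>A1\<close>.\<close>
  have "X * (A1 * X) = X * (A1 * (A1 * (X * X)))" using X'(3) by simp
  also have "\<dots> = X * (A1 * A1) * (X * X)" using d'(1) X'(1) by (simp add: massoc)
  also have "\<dots> = X" using m_core_inverse_mult_square[OF d'(4) X] X'(3) by simp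
  finally show XAX: "X * (A1 * X) = X" .
  show XA2: "X * A2 = 0\<^sub>m n n" by (rule mult_nilpotent_part[OF d X'(1) X'(4) XAX])
  have "A2 * X = A2 * (A1 * (X * X))" using X'(3) by simp
  also have "\<dots> = A2 * A1 * (X * X)" using d'(1,2) X'(1) by (simp add: massoc)
  finally show A2X: "A2 * X = 0\<^sub>m n n" using d'(7) X'(1) by simp
  show "A * X = A1 * X"
    using d'(1-3) X'(1) A2X by (simp add: add_mult_distrib_mat[of _ n n _ _ n])
  show "X * A = X * A1"
    using d'(1-3) X'(1) XA2 by (simp add: mult_add_distrib_mat[of _ n n _ n])
qed

lemma m_core_inverse_is_m_core_EP_inverse:
  assumes d: "is_m_core_EP_decomp n A A1 A2" and X: "is_m_core_inverse n A1 X"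
  shows "is_m_core_EP_inverse n A X"
proof -
  let ?k = "mat_index n A"
  note d' = is_m_core_EP_decompD[OF d]
  note X' = is_m_core_inverse_simps[OF X d'(1)]
  note eqs = m_core_inverse_of_decomp[OF d X]
  have A: "A \<in> M" using d'(1-3) by simp
  obtain S where S: "S \<in> M" "A ^\<^sub>m ?k = A1 * S" using m_core_EP_decomp_pow[OF d] by blast
  \<comment> \<open>The equation \<open>A * (X * X) = X\<close> is what yields the range condition,
    by iteration.\<close>
  have "A * (X * X) = A * X * X" using A X'(1) by (simp add: massoc)
  also have "\<dots> = X" using d'(1) X'(1,3) eqs(4) by (simp add: massoc)
  finally have "A * (X * X) = X" .
  then obtain W where W: "W \<in> M" "X = A ^\<^sub>m ?k * W"
    using outer_factor_pow[OF A X'(1), of ?k] by blast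
  have "X * A ^\<^sub>m (?k + 1) = X * A * (A1 * S)"
    using A d'(1) X'(1) S by (simp add: pow_Suc_left massoc del: pow_mat.simps)
  also have "\<dots> = X * (A1 * A1) * S" using d'(1) X'(1) S eqs(5) by (simp add: massoc)
  also have "\<dots> = A ^\<^sub>m ?k" using m_core_inverse_mult_square[OF d'(4) X] S(2) by simp
  finally have "X * A ^\<^sub>m (?k + 1) = A ^\<^sub>m ?k" .
  moreover have "X * A * X = X" using d'(1) X'(1) eqs(1,5) by (simp add: massoc)
  moreover have "col_space X \<subseteq> col_space (A ^\<^sub>m ?k)"
    using col_space_mult_subset[of "A ^\<^sub>m ?k" n W n] A W by simp
  ultimately show ?thesis
    unfolding is_m_core_EP_inverse_def using X'(1,4) eqs(4) by simp
qed

text \<open>Existence comes from the m-core inverse of \<open>A1\<close>; uniqueness then resolves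
  the definite description.\<close>

lemma m_core_EP_inverse_eq_m_core_inverse:
  assumes d: "is_m_core_EP_decomp n A A1 A2"
  shows "m_core_EP_inverse n A = m_core_inverse n A1"
proof -
  note d' = is_m_core_EP_decompD[OF d]
  have A: "A \<in> M" using d'(1-3) by simp
  have "is_m_core_EP_inverse n A (m_core_inverse n A1)"
    by (rule m_core_inverse_is_m_core_EP_inverse[OF d m_core_inverse_spec[OF d'(4)]])
  then show ?thesis
    unfolding m_core_EP_inverse_def using is_m_core_EP_inverse_unique[OF A] by blast
qed

section \<open>Comparison of the two orders\<close>

lemma order_equations_iff:
  assumes dA: "is_m_core_EP_decomp n A A1 A2" and dB: "is_m_core_EP_decomp n B B1 B2"
    and X: "is_m_core_inverse n A1 X"
  shows "X * A = X * B \<and> A * X = B * X \<longleftrightarrow> X * A1 = X * B1 \<and> A1 * X = B1 * X"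
proof -
  note A = is_m_core_EP_decompD[OF dA] and B = is_m_core_EP_decompD[OF dB]
  note X' = is_m_core_inverse_simps[OF X A(1)]
  note eqs = m_core_inverse_of_decomp[OF dA X]
  have BM: "B \<in> M" using B(1-3) by simp
  have BX: "B * X = B1 * X + B2 * X" and XB: "X * B = X * B1 + X * B2"
    using B(1-3) X'(1) by (simp_all add: add_mult_distrib_mat[of _ n n _ _ n] mult_add_distrib_mat[of _ n n _ n])
  \<comment> \<open>The disjunction serves both directions: by \<open>A * X = A1 * X\<close>, each
    disjunct is the second equation of one of the orders.\<close>
  have B2X: "B2 * X = 0\<^sub>m n n" if eq: "A1 * X = B * X \<or> A1 * X = B1 * X"
    using eq
  proof
    assume eq: "A1 * X = B * X"
    have "B * (X * X) = B * X * X" using BM X'(1) by (simp add: massoc)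
    also have "\<dots> = X" using A(1) X'(1,3) unfolding eq[symmetric] by (simp add: massoc)
    finally show ?thesis by (rule nilpotent_part_annihilates[OF dB X'(1)])
  next
    assume eq: "A1 * X = B1 * X"
    have "B2 * X = B2 * (A1 * X * X)" using A(1) X'(1,3) by (simp add: massoc)
    also have "\<dots> = B2 * B1 * (X * X)" using B(1,2) X'(1) unfolding eq by (simp add: massoc)
    finally show ?thesis using B(7) X'(1) by simp
  qed
  have XB2: "X * B2 = 0\<^sub>m n n" if eq: "A1 * X = B1 * X"
    using X'(4) eqs(1) unfolding eq by (rule mult_nilpotent_part[OF dB X'(1)])
  have BX': "B * X = B1 * X" if "A1 * X = B * X \<or> A1 * X = B1 * X"
    using B(1) X'(1) unfolding BX B2X[OF that] by simp
  have XB': "X * B = X * B1" if "A1 * X = B1 * X"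
    using B(1) X'(1) unfolding XB XB2[OF that] by simp
  \<comment> \<open>From the left side, \<open>BX'\<close> first gives
    \<open>A1 * X = B1 * X\<close>, and only then does \<open>XB'\<close> become available.\<close>
  show ?thesis unfolding eqs(4,5) using BX' XB' by metis
qed

end

theorem theorem4p4:
  fixes n k t r s :: nat
    and A B A1 A2 B1 B2 :: "complex mat"
  assumes "n \<ge> 1"
    and "A \<in> carrier_mat n n" and "B \<in> carrier_mat n n"
    and "mat_index n A = k" and "mat_index n B = t"
    and "vec_space.rank n (A ^\<^sub>m k) = r"
    and "vec_space.rank n (minkowski_adjoint n (A ^\<^sub>m k) * A ^\<^sub>m k) = r"
    and "vec_space.rank n (B ^\<^sub>m t) = s"
    and "vec_space.rank n (minkowski_adjoint n (B ^\<^sub>m t) * B ^\<^sub>m t) = s"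
    and "s \<ge> r"
    and "is_m_core_EP_decomp n A A1 A2"
    and "is_m_core_EP_decomp n B B1 B2"
  shows "m_core_EP_le n A B \<longleftrightarrow> m_core_le n A1 B1"
proof -
  interpret minkowski n by unfold_locales (rule assms(1))
  note dA = assms(11) and dB = assms(12)
  have inv: "m_core_invertible n A1" "m_core_invertible n B1"
    using is_m_core_EP_decompD(4) dA dB by blast+
  \<comment> \<open>Both orders carry domain conditions; once these are established, only the two
    pairs of equations remain to be compared.\<close>
  have "m_core_EP_invertible n A"
    using assms(2,4,6,7) by (simp add: m_core_EP_invertible_def Let_def)
  then show ?thesis
    unfolding m_core_EP_le_def m_core_le_def m_core_EP_inverse_eq_m_core_inverse[OF dA]
    using inv assms(3) order_equations_iff[OF dA dB m_core_inverse_spec[OF inv(1)]] by simp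
qed

end
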